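(* Let $\mathcal{A},\mathcal{B}\in\mathbb{R}^{n\times n\times n_3}$ with $\mathcal{A}\ge\mathcal{B}\ge 0$, and let $0\le r\le 1$. Then $\mathcal{A}^{r}\ge\mathcal{B}^{r}$.
   Context: For $\mathcal{A}\in\mathbb{R}^{n_1\times n_2\times n_3}$ with frontal slices $A^{(1)},\dots,A^{(n_3)}$ (each $n_1\times n_2$), $\mathrm{bcirc}(\mathcal{A})$ is the $n_1n_3\times n_2n_3$ block circulant matrix whose first block column is $A^{(1)},A^{(2)},\dots,A^{(n_3)}$ (top to bottom), i.e. its $(i,j)$ block is $A^{(((i-j)\bmod n_3)+1)}$. $\mathrm{unfold}(\mathcal{A})$ is the first block column of $\mathrm{bcirc}(\mathcal{A})$ and $\mathrm{fold}$ is its inverse. The t-product of $\mathcal{A}\in\mathbb{R}^{n_1\times n_2\times n_3}$ and $\mathcal{B}\in\mathbb{R}^{n_2\times n_4\times n_3}$ is $\mathcal{A}*\mathcal{B}=\mathrm{fold}(\mathrm{bcirc}(\mathcal{A})\cdot\mathrm{unfold}(\mathcal{B}))\in\mathbb{R}^{n_1\times n_4\times n_3}$. The transpose $\mathcal{A}^{T}$ is obtained by transposing each frontal slice and reversing the order of the transposed slices $2,\dots,n_3$; $\mathcal{A}$ is symmetric if $\mathcal{A}^T=\mathcal{A}$. The inner product is $\langle\mathcal{X},\mathcal{Y}\rangle=\sum_{i,j,k}x_{ijk}y_{ijk}$. A tensor $\mathcal{A}\in\mathbb{R}^{n\times n\times n_3}$ is symmetric t-positive semidefinite, written $\mathcal{A}\ge0$,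 if it is symmetric and $\langle\mathcal{X},\mathcal{A}*\mathcal{X}\rangle\ge0$ for all nonzero $\mathcal{X}\in\mathbb{R}^{n\times1\times n_3}$. For symmetric tensors, $\mathcal{A}\ge\mathcal{B}$ (equivalently $\mathcal{B}\le\mathcal{A}$) means $\mathcal{A}-\mathcal{B}\ge0$. For $\mathcal{A}\ge0$ and a real number $r\ge0$, the power $\mathcal{A}^r$ (a tensor t-function) is the tensor with $\mathrm{bcirc}(\mathcal{A}^r)=(\mathrm{bcirc}(\mathcal{A}))^r$, the usual power of a positive semidefinite matrix. The zeroth power is the identity tensor (first frontal slice $I_n$, other slices zero). *)

theory Defs
  imports Complex_Main "Jordan_Normal_Form.Matrix"
begin

(* A real third-order tensor is the list of its frontal slices. Slices, rows and columns are
   indexed from 0, so the slice called A^(k+1) on paper is A ! k. *)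
type_synonym tensor = "real mat list"

definition tensor_carrier :: "nat \<Rightarrow> nat \<Rightarrow> nat \<Rightarrow> tensor set" where
  "tensor_carrier n1 n2 n3 = {A. length A = n3 \<and> set A \<subseteq> carrier_mat n1 n2}"

abbreviation t_rows :: "tensor \<Rightarrow> nat" where "t_rows A \<equiv> dim_row (A ! 0)"

abbreviation t_cols :: "tensor \<Rightarrow> nat" where "t_cols A \<equiv> dim_col (A ! 0)"

(* Entry (p, q) lies in block (p div n1, q div n2), at position (p mod n1, q mod n2).
   The block difference is taken in int because subtraction on nat truncates. *)
definition bcirc :: "tensor \<Rightarrow> real mat" where
  "bcirc A = mat (t_rows A * length A) (t_cols A * length A) (\<lambda>(p, q).
     A ! nat ((int (p div t_rows A) - int (q div t_cols A)) mod int (length A))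
       $$ (p mod t_rows A, q mod t_cols A))"

definition t_unfold :: "tensor \<Rightarrow> real mat" where
  "t_unfold A = mat (dim_row (bcirc A)) (t_cols A) (\<lambda>(p, j). bcirc A $$ (p, j))"

(* The number n3 of blocks cannot be read off from the matrix and is therefore an argument. *)
definition t_fold :: "nat \<Rightarrow> real mat \<Rightarrow> tensor" where
  "t_fold n3 M = map (\<lambda>k. mat (dim_row M div n3) (dim_col M)
     (\<lambda>(i, j). M $$ (k * (dim_row M div n3) + i, j))) [0..<n3]"

definition t_prod :: "tensor \<Rightarrow> tensor \<Rightarrow> tensor" where
  "t_prod A B = t_fold (length A) (bcirc A * t_unfold B)"

fun t_transpose :: "tensor \<Rightarrow> tensor" where
  "t_transpose [] = []"
| "t_transpose (M # Ms) = transpose_mat M # rev (map transpose_mat Ms)"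

definition t_symmetric :: "tensor \<Rightarrow> bool" where
  "t_symmetric A \<longleftrightarrow> t_transpose A = A"

definition t_inner :: "tensor \<Rightarrow> tensor \<Rightarrow> real" where
  "t_inner X Y = (\<Sum>i<t_rows X. \<Sum>j<t_cols X. \<Sum>k<length X. X ! k $$ (i, j) * Y ! k $$ (i, j))"

definition t_zero :: "nat \<Rightarrow> nat \<Rightarrow> nat \<Rightarrow> tensor" where
  "t_zero n1 n2 n3 = replicate n3 (0\<^sub>m n1 n2)"

definition t_minus :: "tensor \<Rightarrow> tensor \<Rightarrow> tensor" where
  "t_minus A B = map2 (-) A B"

definition t_psd :: "nat \<Rightarrow> nat \<Rightarrow> tensor \<Rightarrow> bool" where
  "t_psd n n3 A \<longleftrightarrow> A \<in> tensor_carrier n n n3 \<and> t_symmetric A \<and>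
     (\<forall>X \<in> tensor_carrier n 1 n3. X \<noteq> t_zero n 1 n3 \<longrightarrow> 0 \<le> t_inner X (t_prod A X))"

(* t_ge n n3 A B means A \<ge> B, a relation between symmetric tensors. *)
definition t_ge :: "nat \<Rightarrow> nat \<Rightarrow> tensor \<Rightarrow> tensor \<Rightarrow> bool" where
  "t_ge n n3 A B \<longleftrightarrow> A \<in> tensor_carrier n n n3 \<and> B \<in> tensor_carrier n n n3 \<and>
     t_symmetric A \<and> t_symmetric B \<and> t_psd n n3 (t_minus A B)"

(* In Isabelle 0 powr 0 = 0, whereas the zeroth power of a matrix is the identity, also when
   the matrix is singular; hence the separate case. *)
definition scalar_rpow :: "real \<Rightarrow> real \<Rightarrow> real" where
  "scalar_rpow x r = (if r = 0 then 1 else x powr r)"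

(* The usual power of a symmetric positive semidefinite matrix: if M = P D P^T with P orthogonal
   and D diagonal with nonnegative entries, then M^r = P D^r P^T. This does not depend on the
   chosen decomposition. For other M the value is unspecified. *)
definition mat_rpow :: "real mat \<Rightarrow> real \<Rightarrow> real mat" where
  "mat_rpow M r = (let m = dim_row M in THE N. \<exists>P d.
     P \<in> carrier_mat m m \<and> P * transpose_mat P = 1\<^sub>m m \<and> transpose_mat P * P = 1\<^sub>m m \<and>
     (\<forall>i<m. 0 \<le> d i) \<and>
     M = P * mat_diag m d * transpose_mat P \<and>
     N = P * mat_diag m (\<lambda>i. scalar_rpow (d i) r) * transpose_mat P)"

definition t_power :: "tensor \<Rightarrow> real \<Rightarrow> tensor" where
  "t_power A r = (THE C. C \<in> tensor_carrier (t_rows A) (t_cols A) (length A) \<and>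
     bcirc C = mat_rpow (bcirc A) r)"

lemma t_fold_unfold:
  assumes "A \<in> tensor_carrier n1 n2 n3" "0 < n1" "0 < n2" "0 < n3"
  shows "t_fold n3 (t_unfold A) = A"
proof (rule nth_equalityI)
  have len: "length A = n3" and c: "A ! k \<in> carrier_mat n1 n2" if "k < n3" for k
    using assms that by (auto simp: tensor_carrier_def)
  have len: "length A = n3" using assms by (auto simp: tensor_carrier_def)
  have d: "t_rows A = n1" "t_cols A = n2" using c[of 0] assms by auto
  show "length (t_fold n3 (t_unfold A)) = length A" by (simp add: t_fold_def len)
  fix k assume "k < length (t_fold n3 (t_unfold A))"
  then have k: "k < n3" by (simp add: t_fold_def)
  have lt: "k * n1 + i < n1 * n3" if "i < n1" for i
  proof -
    have "k * n1 + i < Suc k * n1" using that by simp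
    also have "\<dots> \<le> n3 * n1" using k by (intro mult_right_mono) auto
    finally show ?thesis by (simp add: mult.commute)
  qed
  have q: "j < n2 * n3" if "j < n2" for j
    using that assms(4) by (metis mult.right_neutral mult_le_mono2 Suc_leI One_nat_def less_le_trans)
  show "t_fold n3 (t_unfold A) ! k = A ! k"
    by (rule eq_matI)
      (use k c[OF k] assms in \<open>auto simp: t_fold_def t_unfold_def bcirc_def len d lt q nat_mod_distrib\<close>)
qed

end

theory Submission
  imports Defs "HOL-Analysis.Equivalence_Lebesgue_Henstock_Integration" "Jordan_Normal_Form.Spectral_Radius"
begin

text \<open>
  The map \<open>bcirc\<close> is injective and linear, turns \<open>t_transpose\<close> into matrix transposition, and
  turns the form \<open>\<langle>X, A * X\<rangle>\<close> into the ordinary quadratic form of \<open>bcirc A\<close>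
  (\<open>bcirc_inject\<close>, \<open>bcirc_t_minus\<close>, \<open>bcirc_t_transpose\<close>, \<open>t_inner_t_prod\<close>). Hence the order on
  symmetric tensors is the Loewner order on block circulant matrices, and the theorem is the
  Loewner--Heinz inequality for these matrices, provided the power of a block circulant matrix
  is again block circulant. The latter holds because being block circulant means being invariant
  under simultaneous cyclic shifts of the row and column blocks: shifting the rows of the
  diagonalizing matrix gives another diagonalization of the same matrix, and the power does not
  depend on the diagonalization (\<open>functional_calculus_unique\<close>,
  \<open>mat_rpow_permutation_invariant\<close>, \<open>t_power_bcirc\<close>).

  The Loewner--Heinz inequality (\<open>loewner_heinz\<close>) is reduced to rational functions by the integral
  \[ c\, x^r = \int_0^\infty t^{r-1} \frac{x}{x+t}\, dt \qquad (0 < r < 1,\ c > 0), \]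
  so it is enough that \<open>M(M + t)\<inverse>\<close> is monotone in the positive semidefinite matrix \<open>M\<close> for every
  \<open>t > 0\<close> (\<open>resolvent_sums_mono\<close>). This monotonicity is visible from the variational formula
  \[ t\, \langle w, M(M+t)^{-1} w\rangle = \min_x\, \bigl( \langle x, Mx\rangle + t\,|w-x|^2 \bigr), \]
  whose right-hand side is monotone in \<open>M\<close>. The exponents \<open>0\<close> and \<open>1\<close> are immediate.

  Diagonalizations exist by the spectral theorem for real symmetric matrices
  (\<open>real_spectral_theorem\<close>), proved by induction on the dimension: a complex eigenvector has a
  real or imaginary part that is a real eigenvector, and a Householder reflection moves it to the
  first basis vector.
\<close>

(* The names and notations below would otherwise clash with those for matrices and vectors of
   dimension given by a term. *)
hide_const (open) Finite_Cartesian_Product.vec Finite_Cartesian_Product.mat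
hide_type (open) Finite_Cartesian_Product.vec
no_notation vec_nth (infixl "$" 90)
no_notation inner (infix "\<bullet>" 70)

section \<open>Fractional powers as integrals of rational functions\<close>

text \<open>
  The kernel is dominated by \<open>t powr (r - 1)\<close> near \<open>0\<close>, integrable because \<open>r > 0\<close>, and by
  \<open>t powr (r - 2)\<close> near infinity, integrable because \<open>r < 1\<close>.
\<close>
lemma resolvent_kernel_integrable:
  fixes r :: real
  assumes r: "0 < r" "r < 1"
  shows "integrable lborel (\<lambda>t. indicator {0<..} t * (t powr (r - 1) / (1 + t)))"
proof -
  let ?g = "\<lambda>t::real. indicator {0..1} t * t powr (r - 1) + indicator {1..} t * t powr (r - 2)"
  have "(\<lambda>t. t powr (r - 1)) absolutely_integrable_on {0..1}"
    by (subst absolutely_integrable_on_iff_nonneg) (use r integrable_on_powr_from_0 in auto)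
  then have 1: "integrable lborel (\<lambda>t. indicator {0..1} t * t powr (r - 1))"
    unfolding set_integrable_def by (subst (asm) integrable_completion) auto
  have "(\<lambda>t. t powr (r - 2)) absolutely_integrable_on {1..}"
    by (subst absolutely_integrable_on_iff_nonneg)
      (use r has_integral_powr_to_inf[of "r - 2" 1] in \<open>auto simp: integrable_on_def\<close>)
  then have 2: "integrable lborel (\<lambda>t. indicator {1..} t * t powr (r - 2))"
    unfolding set_integrable_def by (subst (asm) integrable_completion) auto
  show ?thesis
  proof (rule Bochner_Integration.integrable_bound[OF Bochner_Integration.integrable_add[OF 1 2]])
    show "AE t in lborel. norm (indicator {0<..} t * (t powr (r - 1) / (1 + t))) \<le> norm (?g t)"
    proof (rule AE_I2)
      fix t :: real
      have "t powr (r - 1) / (1 + t) \<le> t powr (r - 1)" if "0 < t"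
        using that by (simp add: field_simps)
      moreover have "t powr (r - 1) / (1 + t) \<le> t powr (r - 2)" if "1 < t"
      proof -
        have "t powr (r - 1) = t * t powr (r - 2)"
          using that powr_add[of t 1 "r - 2"] by simp
        then show ?thesis using that by (simp add: field_simps)
      qed
      ultimately show "norm (indicator {0<..} t * (t powr (r - 1) / (1 + t))) \<le> norm (?g t)"
        by (auto simp: indicator_def)
    qed
  qed measurable
qed

text \<open>
  The substitution \<open>t = x s\<close> pulls the factor \<open>x powr r\<close> out of the integral, so the constant is
  the value at \<open>x = 1\<close>, which is positive because the kernel is.
\<close>
lemma powr_integral_representation:
  fixes r :: real
  assumes r: "0 < r" "r < 1"
  obtains c where "0 < c"
    and "\<And>x. 0 \<le> x \<Longrightarrow> has_bochner_integral lborel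
           (\<lambda>t. indicator {0<..} t * (t powr (r - 1) * (x / (x + t)))) (c * x powr r)"
proof -
  let ?k = "\<lambda>t::real. indicator {0<..} t * (t powr (r - 1) / (1 + t)) :: real"
  define c where "c = integral\<^sup>L lborel ?k"
  have int: "integrable lborel ?k" by (rule resolvent_kernel_integrable[OF r])
  \<comment> \<open>a zero integral would make the positive kernel vanish almost everywhere, in particular on (0,1)\<close>
  have "c \<noteq> 0"
  proof
    assume "c = 0"
    then have "AE t in lborel. ?k t = 0"
      unfolding c_def by (subst (asm) integral_nonneg_eq_0_iff_AE[OF int]) (auto intro!: AE_I2 simp: indicator_def)
    then have "AE t in lborel. t \<notin> {0<..<1::real}"
      by eventually_elim (auto simp: indicator_def)
    then have "emeasure lborel {0<..<1::real} = 0"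
      by (subst (asm) AE_iff_measurable[of "{0<..<1}"]) auto
    then show False by simp
  qed
  moreover have "0 \<le> c" unfolding c_def by (intro integral_nonneg_AE AE_I2) (auto simp: indicator_def)
  ultimately have c: "0 < c" by simp
  show thesis
  proof (rule that[OF c])
    fix x :: real assume "0 \<le> x"
    let ?f = "\<lambda>t. indicator {0<..} t * (t powr (r - 1) * (x / (x + t))) :: real"
    show "has_bochner_integral lborel ?f (c * x powr r)"
    proof (cases "x = 0")
      case False
      with \<open>0 \<le> x\<close> have x: "0 < x" by simp
      have scale: "?f (0 + x * s) = x powr (r - 1) * ?k s" for s
      proof -
        have "x / (x + x * s) = 1 / (1 + s)"
          using x by (metis distrib_left mult.right_neutral nonzero_mult_divide_mult_cancel_left less_irrefl)
        then show ?thesis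
          using x by (auto simp: indicator_def powr_mult zero_less_mult_iff)
      qed
      have "integrable lborel (\<lambda>s. ?f (0 + x * s))"
        unfolding scale by (intro integrable_mult_right int)
      then have i: "integrable lborel ?f"
        using x by (subst (asm) lborel_integrable_real_affine_iff) auto
      have "integral\<^sup>L lborel ?f = \<bar>x\<bar> *\<^sub>R (\<integral>s. ?f (0 + x * s) \<partial>lborel)"
        using x by (intro lborel_integral_real_affine) simp
      also have "\<dots> = x * (x powr (r - 1) * c)"
        unfolding scale c_def integral_mult_right_zero using x by simp
      also have "\<dots> = c * x powr r"
        using x powr_add[of x 1 "r - 1"] by simp
      finally show ?thesis using i by (simp add: has_bochner_integral_iff)
    qed (simp add: has_bochner_integral_zero)
  qed
qed

text \<open>
  Integrating the hypothesis against the positive weight \<open>t powr (r - 1)\<close> gives the conclusion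
  times a positive constant.
\<close>
lemma powr_sum_mono_of_resolvent_sums:
  fixes r :: real and a b x y :: "nat \<Rightarrow> real"
  assumes r: "0 < r" "r < 1"
    and x: "\<And>i. i < m \<Longrightarrow> 0 \<le> x i" and y: "\<And>i. i < m \<Longrightarrow> 0 \<le> y i"
    and le: "\<And>t. 0 < t \<Longrightarrow> (\<Sum>i<m. a i * (x i / (x i + t))) \<le> (\<Sum>i<m. b i * (y i / (y i + t)))"
  shows "(\<Sum>i<m. a i * x i powr r) \<le> (\<Sum>i<m. b i * y i powr r)"
proof -
  obtain c where c: "0 < c"
    and h: "\<And>x. 0 \<le> x \<Longrightarrow> has_bochner_integral lborel
           (\<lambda>t. indicator {0<..} t * (t powr (r - 1) * (x / (x + t)))) (c * x powr r)"
    using powr_integral_representation[OF r] by blast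
  define F where "F = (\<lambda>(a :: nat \<Rightarrow> real) x t. \<Sum>i<m. a i * (indicator {0<..} t * (t powr (r - 1) * (x i / (x i + t)))))"
  have S: "has_bochner_integral lborel (F a x) (\<Sum>i<m. a i * (c * x i powr r))"
    if "\<And>i. i < m \<Longrightarrow> 0 \<le> x i" for a x :: "nat \<Rightarrow> real"
    unfolding F_def
    by (intro has_bochner_integral_sum has_bochner_integral_mult_right h) (use that in auto)
  have "integral\<^sup>L lborel (F a x) \<le> integral\<^sup>L lborel (F b y)"
  proof (rule integral_mono)
    fix t :: real
    have "F a x t = (indicator {0<..} t * t powr (r - 1)) * (\<Sum>i<m. a i * (x i / (x i + t)))"
      for a x :: "nat \<Rightarrow> real"
      unfolding F_def by (subst sum_distrib_left) (simp add: mult_ac)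
    then show "F a x t \<le> F b y t"
      using le[of t] by (cases "0 < t") (auto intro!: mult_left_mono simp: indicator_def)
  qed (use S[OF x] S[OF y] in \<open>auto simp: has_bochner_integral_iff\<close>)
  then have "c * (\<Sum>i<m. a i * x i powr r) \<le> c * (\<Sum>i<m. b i * y i powr r)"
    using S[where a = a and x = x, OF x] S[where a = b and x = y, OF y]
    by (simp add: has_bochner_integral_iff sum_distrib_left mult_ac)
  then show ?thesis using c by simp
qed

section \<open>Spectral theorem for real symmetric matrices\<close>

lemma mult_mat_vec_nth:
  assumes "A \<in> carrier_mat m n" "v \<in> carrier_vec n" "i < m"
  shows "(A *\<^sub>v v) $ i = (\<Sum>j<n. A $$ (i, j) * v $ j)"
  using assms by (simp add: scalar_prod_def atLeast0LessThan)

lemma mult_mat_nth: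
  assumes "A \<in> carrier_mat m n" "B \<in> carrier_mat n l" "i < m" "j < l"
  shows "(A * B) $$ (i, j) = (\<Sum>k<n. A $$ (i, k) * B $$ (k, j))"
  using assms by (simp add: scalar_prod_def atLeast0LessThan)

text \<open>
  Over the complex numbers an eigenvector \<open>z = x + iy\<close> with eigenvalue \<open>l\<close> exists. Evaluating
  \<open>y \<bullet> M x = x \<bullet> M y\<close> with the real and imaginary parts of \<open>M z = l z\<close> yields
  \<open>Im l * (x \<bullet> x + y \<bullet> y) = 0\<close>; so \<open>l\<close> is real, and whichever of \<open>x\<close>, \<open>y\<close> is nonzero is a real
  eigenvector.
\<close>
lemma real_symmetric_unit_eigenvector:
  fixes M :: "real mat"
  assumes M: "M \<in> carrier_mat n n" and sym: "transpose_mat M = M" and n: "0 < n"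
  obtains v a where "v \<in> carrier_vec n" "v \<bullet> v = 1" "M *\<^sub>v v = a \<cdot>\<^sub>v v"
proof -
  let ?C = "map_mat complex_of_real M"
  have C: "?C \<in> carrier_mat n n" using M by simp
  obtain z l where "eigenvector ?C z l"
    using spectrum_non_empty[OF C n] by (auto simp: spectrum_def eigenvalue_def)
  then have z: "z \<in> carrier_vec n" "z \<noteq> 0\<^sub>v n" and ev: "?C *\<^sub>v z = l \<cdot>\<^sub>v z"
    using C by (auto simp: eigenvector_def)
  have sym': "M $$ (i, j) = M $$ (j, i)" if "i < n" "j < n" for i j
    using that M arg_cong[OF sym, of "\<lambda>A. A $$ (i, j)"] by simp
  define x y where "x = (\<lambda>i. Re (z $ i))" and "y = (\<lambda>i. Im (z $ i))"
  have ev': "(\<Sum>j<n. complex_of_real (M $$ (i, j)) * z $ j) = l * z $ i" if "i < n" for i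
    using arg_cong[OF ev, of "\<lambda>u. u $ i"] mult_mat_vec_nth[OF C z(1) that] that z(1) M by simp
  have Mx: "(\<Sum>j<n. M $$ (i, j) * x j) = Re l * x i - Im l * y i" if "i < n" for i
    using arg_cong[OF ev'[OF that], of Re] by (simp add: x_def y_def)
  have My: "(\<Sum>j<n. M $$ (i, j) * y j) = Im l * x i + Re l * y i" if "i < n" for i
    using arg_cong[OF ev'[OF that], of Im] by (simp add: x_def y_def)
  have "(\<Sum>i<n. y i * (\<Sum>j<n. M $$ (i, j) * x j)) = (\<Sum>i<n. x i * (\<Sum>j<n. M $$ (i, j) * y j))"
    unfolding sum_distrib_left
    by (subst sum.swap) (auto intro!: sum.cong simp: sym')
  then have "(\<Sum>i<n. y i * (Re l * x i - Im l * y i)) = (\<Sum>i<n. x i * (Im l * x i + Re l * y i))"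
    by (simp add: Mx My)
  then have "Im l * (\<Sum>i<n. x i * x i + y i * y i) = 0"
    by (simp add: sum.distrib sum_subtractf sum_distrib_left algebra_simps)
  moreover have "0 < (\<Sum>i<n. x i * x i + y i * y i)"
  proof -
    obtain i where "i < n" "z $ i \<noteq> 0" using z by (metis eq_vecI carrier_vecD index_zero_vec)
    then show ?thesis
      by (intro sum_pos2[of _ i]) (auto simp: x_def y_def complex_eq_iff sum_squares_gt_zero_iff)
  qed
  ultimately have im: "Im l = 0" by simp
  note result = that
  have norm: thesis if i: "i < n" and u0: "u i \<noteq> 0"
    and Mu: "\<And>i. i < n \<Longrightarrow> (\<Sum>j<n. M $$ (i, j) * u j) = Re l * u i" for u :: "nat \<Rightarrow> real" and i
  proof -
    define s where "s = (\<Sum>i<n. u i * u i)"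
    have s: "0 < s" unfolding s_def
      by (rule sum_pos2[of _ i]) (use i u0 in \<open>auto simp: zero_less_mult_iff\<close>)
    define v where "v = vec n (\<lambda>i. u i / sqrt s)"
    show thesis
    proof (rule result)
      show v: "v \<in> carrier_vec n" by (simp add: v_def)
      have "v \<bullet> v = (\<Sum>i<n. u i * u i / s)"
        using s by (auto simp: v_def scalar_prod_def atLeast0LessThan intro!: sum.cong)
      also have "\<dots> = 1" using s by (simp add: s_def flip: sum_divide_distrib)
      finally show "v \<bullet> v = 1" .
      show "M *\<^sub>v v = Re l \<cdot>\<^sub>v v"
      proof (rule eq_vecI)
        fix i assume "i < dim_vec (Re l \<cdot>\<^sub>v v)"
        then have i: "i < n" using v by simp
        have "(M *\<^sub>v v) $ i = (\<Sum>j<n. M $$ (i, j) * u j) / sqrt s"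
          unfolding mult_mat_vec_nth[OF M v i] by (simp add: v_def sum_divide_distrib)
        then show "(M *\<^sub>v v) $ i = (Re l \<cdot>\<^sub>v v) $ i" using i by (simp add: Mu v_def)
      qed (use M v in auto)
    qed
  qed
  obtain i where "i < n" "z $ i \<noteq> 0" using z by (metis eq_vecI carrier_vecD index_zero_vec)
  then have "i < n" "x i \<noteq> 0 \<or> y i \<noteq> 0" by (auto simp: x_def y_def complex_eq_iff)
  then show thesis using norm[of i x] norm[of i y] Mx My im by auto
qed

text \<open>
  The reflection in the hyperplane orthogonal to \<open>u = v - e\<^sub>0\<close> exchanges the unit vectors \<open>v\<close> and
  \<open>e\<^sub>0\<close>. Since \<open>u \<bullet> u = 2 (1 - v $ 0)\<close>, the factor \<open>2 / (u \<bullet> u)\<close> of the reflection is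
  \<open>1 / (1 - v $ 0)\<close>. For \<open>v = e\<^sub>0\<close> the factor \<open>0\<close> gives the identity matrix.
\<close>
lemma householder_reflection:
  fixes v :: "real vec"
  assumes v: "v \<in> carrier_vec n" and unit: "v \<bullet> v = 1" and n: "0 < n"
  obtains H where "H \<in> carrier_mat n n" "transpose_mat H = H" "H * H = 1\<^sub>m n" "col H 0 = v"
proof -
  define u where "u = (\<lambda>i. v $ i - (if i = 0 then 1 else 0))"
  define c where "c = (if v $ 0 = 1 then 0 else 1 / (1 - v $ 0))"
  define H where "H = mat n n (\<lambda>(i, j). (if i = j then 1 else 0) - c * u i * u j)"
  have vv: "(\<Sum>i<n. v $ i * v $ i) = 1"
    using unit v by (simp add: scalar_prod_def atLeast0LessThan)
  have uu: "(\<Sum>i<n. u i * u i) = 2 * (1 - v $ 0)"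
  proof -
    have "u i * u i = v $ i * v $ i + (if i = 0 then 1 - 2 * v $ 0 else 0)" for i
      by (simp add: u_def algebra_simps)
    then show ?thesis using n vv by (simp add: sum.distrib)
  qed
  have first: "(if i = 0 then 1 else 0) - c * u i * u 0 = v $ i" if i: "i < n" for i
  proof (cases "v $ 0 = 1")
    case True
    then have "u i * u i = 0" using uu i by (simp add: sum_nonneg_eq_0_iff)
    then show ?thesis using True by (auto simp: c_def u_def split: if_splits)
  next
    case False
    then have "c * u 0 = -1" by (simp add: c_def u_def field_simps)
    then have "c * u i * u 0 = - u i" by (metis mult.assoc mult.commute mult_minus1)
    then show ?thesis by (simp add: u_def)
  qed
  have cc: "c * c * (\<Sum>i<n. u i * u i) = 2 * c"
  proof -
    have "c = 0 \<or> c * (1 - v $ 0) = 1" by (simp add: c_def)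
    then show ?thesis
    proof
      assume "c * (1 - v $ 0) = 1"
      moreover have "c * c * (2 * (1 - v $ 0)) = 2 * c * (c * (1 - v $ 0))"
        by (simp only: mult_ac)
      ultimately show ?thesis unfolding uu by (simp only: mult.right_neutral)
    qed simp
  qed
  show thesis
  proof (rule that[of H])
    show H: "H \<in> carrier_mat n n" by (simp add: H_def)
    show "transpose_mat H = H" by (rule eq_matI) (auto simp: H_def)
    show "col H 0 = v" by (rule eq_vecI) (use v n first in \<open>auto simp: H_def\<close>)
    show "H * H = 1\<^sub>m n"
    proof (rule eq_matI)
      fix i j assume "i < dim_row (1\<^sub>m n :: real mat)" "j < dim_col (1\<^sub>m n :: real mat)"
      then have ij: "i < n" "j < n" by auto
      have "(H * H) $$ (i, j) = (\<Sum>k<n. ((if i = k then 1 else 0) - c * u i * u k) * ((if k = j then 1 else 0) - c * u k * u j))"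
        unfolding mult_mat_nth[OF H H ij] using ij by (simp add: H_def)
      also have "\<dots> = (\<Sum>k<n. (if k = i then (if i = j then 1 else 0) - c * u i * u j else 0) - (if k = j then c * u i * u j else 0)
          + (c * c * (u k * u k)) * (u i * u j))"
        by (rule sum.cong) (auto simp: algebra_simps)
      also have "\<dots> = (if i = j then 1 else 0) - 2 * c * u i * u j + (c * c * (\<Sum>k<n. u k * u k)) * (u i * u j)"
        using ij by (simp add: sum.distrib sum_subtractf flip: sum_distrib_left sum_distrib_right)
      also have "\<dots> = 1\<^sub>m n $$ (i, j)" unfolding cc using ij by simp
      finally show "(H * H) $$ (i, j) = 1\<^sub>m n $$ (i, j)" .
    qed (use H in auto)
  qed
qed

definition orthogonal_diagonalization :: "nat \<Rightarrow> real mat \<Rightarrow> real mat \<Rightarrow> (nat \<Rightarrow> real) \<Rightarrow> bool" where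
  "orthogonal_diagonalization m M P d \<longleftrightarrow> P \<in> carrier_mat m m \<and> P * transpose_mat P = 1\<^sub>m m \<and>
     transpose_mat P * P = 1\<^sub>m m \<and> M = P * mat_diag m d * transpose_mat P"

lemma mat_diag_dims [simp]: "dim_row (mat_diag n f) = n" "dim_col (mat_diag n f) = n"
  by (simp_all add: mat_diag_def)

lemma mult_diag_transpose_nth:
  fixes P :: "'a :: comm_semiring_1 mat"
  assumes P: "P \<in> carrier_mat m m" and ij: "i < m" "j < m"
  shows "(P * mat_diag m f * transpose_mat P) $$ (i, j) = (\<Sum>k<m. P $$ (i, k) * f k * P $$ (j, k))"
proof -
  have "P * mat_diag m f \<in> carrier_mat m m" "transpose_mat P \<in> carrier_mat m m" using P by auto
  from mult_mat_nth[OF this ij] show ?thesis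
    using P ij by (simp add: mat_diag_mult_right[OF P])
qed

text \<open>
  For a unit eigenvector \<open>v\<close> and a reflection \<open>H\<close> with first column \<open>v\<close>, the matrix \<open>K = H M H\<close> has
  first column a multiple of the first basis vector, and by symmetry the same first row. The
  remaining block \<open>L\<close> is symmetric and diagonalized by induction; \<open>R\<close> is the block diagonal matrix
  of \<open>1\<close> and the matrix diagonalizing \<open>L\<close>.
\<close>
theorem real_spectral_theorem:
  fixes M :: "real mat"
  assumes "M \<in> carrier_mat n n" "transpose_mat M = M"
  shows "\<exists>P d. orthogonal_diagonalization n M P d"
  using assms
proof (induction n arbitrary: M)
  case 0
  then have "orthogonal_diagonalization 0 M (1\<^sub>m 0) (\<lambda>_. 0)"
    by (auto simp: orthogonal_diagonalization_def intro!: eq_matI)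
  then show ?case by blast
next
  case (Suc n)
  let ?N = "Suc n"
  note M = Suc.prems(1) and sym = Suc.prems(2)
  obtain v a where v: "v \<in> carrier_vec ?N" "v \<bullet> v = 1" and Mv: "M *\<^sub>v v = a \<cdot>\<^sub>v v"
    using real_symmetric_unit_eigenvector[OF M sym] by blast
  obtain H where H: "H \<in> carrier_mat ?N ?N" and Hs: "transpose_mat H = H" and HH: "H * H = 1\<^sub>m ?N"
    and Hv: "col H 0 = v"
    using householder_reflection[OF v] by blast
  define K where "K = H * M * H"
  have K: "K \<in> carrier_mat ?N ?N" using H M by (simp add: K_def)
  have Ks: "transpose_mat K = K"
    using H M by (simp add: K_def transpose_mult[of _ ?N ?N _ ?N] Hs sym assoc_mult_mat[of _ ?N ?N _ ?N _ ?N])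
  have "col K 0 = (H * M) *\<^sub>v v"
    unfolding K_def using H M by (subst col_mult2[of _ ?N ?N _ ?N]) (auto simp: Hv)
  also have "\<dots> = H *\<^sub>v (a \<cdot>\<^sub>v v)"
    using H M v by (subst assoc_mult_mat_vec[of _ ?N ?N _ ?N]) (auto simp: Mv)
  also have "\<dots> = a \<cdot>\<^sub>v (H *\<^sub>v v)" using H v by (simp add: mult_mat_vec[of _ ?N ?N])
  also have "H *\<^sub>v v = col (H * H) 0"
    using H by (subst col_mult2[of _ ?N ?N _ ?N]) (auto simp: Hv)
  also have "\<dots> = unit_vec ?N 0" unfolding HH by simp
  finally have col0: "col K 0 = a \<cdot>\<^sub>v unit_vec ?N 0" .
  have K0: "K $$ (i, 0) = (if i = 0 then a else 0)" if "i < ?N" for i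
    using arg_cong[OF col0, of "\<lambda>w. w $ i"] that K by auto
  have K0': "K $$ (0, i) = (if i = 0 then a else 0)" if "i < ?N" for i
    using K0[OF that] that K arg_cong[OF Ks, of "\<lambda>A. A $$ (0, i)"] by simp
  define L where "L = mat n n (\<lambda>(i, j). K $$ (Suc i, Suc j))"
  have L: "L \<in> carrier_mat n n" by (simp add: L_def)
  have Ls: "transpose_mat L = L"
  proof (rule eq_matI)
    fix i j assume "i < dim_row L" "j < dim_col L"
    then have ij: "i < n" "j < n" using L by auto
    then have "K $$ (Suc j, Suc i) = K $$ (Suc i, Suc j)"
      using K arg_cong[OF Ks, of "\<lambda>A. A $$ (Suc i, Suc j)"] by simp
    then show "transpose_mat L $$ (i, j) = L $$ (i, j)" using ij by (simp add: L_def)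
  qed (use L in auto)
  obtain P d where Q: "orthogonal_diagonalization n L P d" using Suc.IH[OF L Ls] by blast
  then have P: "P \<in> carrier_mat n n" and PP: "P * transpose_mat P = 1\<^sub>m n"
    and Ld: "L = P * mat_diag n d * transpose_mat P"
    by (auto simp: orthogonal_diagonalization_def)
  define R where "R = mat ?N ?N (\<lambda>(i, j). if i = 0 \<or> j = 0 then (if i = j then 1 else 0) else P $$ (i - 1, j - 1))"
  define e where "e = (\<lambda>i. if i = 0 then a else d (i - 1))"
  have R: "R \<in> carrier_mat ?N ?N" by (simp add: R_def)
  \<comment> \<open>used below with f = 1, for orthogonality, and with f = e, for the diagonalization\<close>
  have RfR: "(R * mat_diag ?N f * transpose_mat R) $$ (i, j) =
      (if i = 0 \<or> j = 0 then (if i = j then f 0 else 0)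
       else (P * mat_diag n (\<lambda>k. f (Suc k)) * transpose_mat P) $$ (i - 1, j - 1))"
    if "i < ?N" "j < ?N" for i j f
    using that P unfolding mult_diag_transpose_nth[OF R that]
    by (cases i; cases j) (auto simp: R_def mult_diag_transpose_nth[OF P] sum.lessThan_Suc_shift simp del: sum.lessThan_Suc index_mult_mat(1))
  have RR: "R * transpose_mat R = 1\<^sub>m ?N"
  proof -
    have "R * mat_diag ?N (\<lambda>_. 1) * transpose_mat R = 1\<^sub>m ?N"
      by (rule eq_matI) (use R RfR[of _ _ "\<lambda>_. 1"] P PP in \<open>auto simp: mat_diag_one\<close>)
    then show ?thesis using R by (simp add: mat_diag_one)
  qed
  have KR: "K = R * mat_diag ?N e * transpose_mat R"
  proof (rule eq_matI)
    fix i j assume "i < dim_row (R * mat_diag ?N e * transpose_mat R)"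
      "j < dim_col (R * mat_diag ?N e * transpose_mat R)"
    then have ij: "i < ?N" "j < ?N" using R by auto
    show "K $$ (i, j) = (R * mat_diag ?N e * transpose_mat R) $$ (i, j)"
      unfolding RfR[OF ij] using ij K0[OF ij(1)] K0'[OF ij(2)]
      by (cases i; cases j) (auto simp: e_def Ld[symmetric], auto simp: L_def)
  qed (use K R in auto)
  define U where "U = H * R"
  have U: "U \<in> carrier_mat ?N ?N" using H R by (simp add: U_def)
  have Ut: "transpose_mat U = transpose_mat R * H"
    using H R by (simp add: U_def transpose_mult[of _ ?N ?N _ ?N] Hs)
  have Rt: "transpose_mat R \<in> carrier_mat ?N ?N" using R by simp
  have UU: "U * transpose_mat U = 1\<^sub>m ?N"
  proof -
    have "U * transpose_mat U = H * (R * transpose_mat R) * H"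
      unfolding Ut unfolding U_def using H R Rt by (simp add: assoc_mult_mat[of _ ?N ?N _ ?N _ ?N])
    then show ?thesis using H by (simp add: RR HH)
  qed
  have "M = (H * H) * M * (H * H)" using M by (simp add: HH)
  also have "\<dots> = H * K * H"
    using H M by (simp add: K_def assoc_mult_mat[of _ ?N ?N _ ?N _ ?N])
  also have "\<dots> = U * mat_diag ?N e * transpose_mat U"
  proof -
    have "H * (R * D * transpose_mat R) * H = (H * R) * D * (transpose_mat R * H)"
      if "D \<in> carrier_mat ?N ?N" for D :: "real mat"
      using that H R Rt by (simp add: assoc_mult_mat[of _ ?N ?N _ ?N _ ?N])
    then show ?thesis unfolding Ut unfolding U_def KR by simp
  qed
  finally have "orthogonal_diagonalization ?N M U e"
    using U UU mat_mult_left_right_inverse[OF U _ UU]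
    by (simp add: orthogonal_diagonalization_def)
  then show ?case by blast
qed

section \<open>Powers of positive semidefinite matrices\<close>

text \<open>
  Vectors are functions on indices, of which only the values at valid indices matter. This avoids
  carrier conditions on vectors throughout.
\<close>
definition quad_form :: "real mat \<Rightarrow> (nat \<Rightarrow> real) \<Rightarrow> real" where
  "quad_form M x = (\<Sum>p<dim_row M. \<Sum>q<dim_col M. x p * M $$ (p, q) * x q)"

definition psd_mat :: "nat \<Rightarrow> real mat \<Rightarrow> bool" where
  "psd_mat m M \<longleftrightarrow> M \<in> carrier_mat m m \<and> transpose_mat M = M \<and> (\<forall>x. 0 \<le> quad_form M x)"

text \<open>
  The \<open>k\<close>-th coordinate of \<open>x\<close> in the basis formed by the columns of \<open>P\<close>, i.e. entry \<open>k\<close> of \<open>P\<^sup>T x\<close>.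
\<close>
abbreviation coord :: "nat \<Rightarrow> real mat \<Rightarrow> (nat \<Rightarrow> real) \<Rightarrow> nat \<Rightarrow> real" where
  "coord m P x k \<equiv> (\<Sum>p<m. P $$ (p, k) * x p)"

lemma quad_form_diagonalized:
  assumes P: "P \<in> carrier_mat m m"
  shows "quad_form (P * mat_diag m f * transpose_mat P) x = (\<Sum>k<m. f k * (coord m P x k)\<^sup>2)"
proof -
  have "quad_form (P * mat_diag m f * transpose_mat P) x
      = (\<Sum>p<m. \<Sum>q<m. \<Sum>k<m. f k * ((P $$ (p, k) * x p) * (P $$ (q, k) * x q)))"
    using P unfolding quad_form_def
    by (auto simp del: index_mult_mat(1) simp: mult_diag_transpose_nth[OF P] sum_distrib_left sum_distrib_right mult_ac
        intro!: sum.cong)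
  also have "\<dots> = (\<Sum>p<m. \<Sum>k<m. \<Sum>q<m. f k * ((P $$ (p, k) * x p) * (P $$ (q, k) * x q)))"
    by (intro sum.cong refl sum.swap)
  also have "\<dots> = (\<Sum>k<m. \<Sum>p<m. \<Sum>q<m. f k * ((P $$ (p, k) * x p) * (P $$ (q, k) * x q)))"
    by (rule sum.swap)
  also have "\<dots> = (\<Sum>k<m. f k * (coord m P x k)\<^sup>2)"
    unfolding power2_eq_square sum_product by (simp add: sum_distrib_left)
  finally show ?thesis .
qed

lemma coord_parseval:
  assumes P: "P \<in> carrier_mat m m" and PP: "P * transpose_mat P = 1\<^sub>m m"
  shows "(\<Sum>k<m. (coord m P x k)\<^sup>2) = (\<Sum>p<m. (x p)\<^sup>2)"
proof -
  have "(\<Sum>k<m. (coord m P x k)\<^sup>2) = quad_form (1\<^sub>m m) x"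
    using quad_form_diagonalized[OF P, of "\<lambda>_. 1" x] P by (simp add: mat_diag_one PP right_mult_one_mat[of _ m m])
  also have "\<dots> = (\<Sum>p<m. \<Sum>q<m. if q = p then x p * x p else 0)"
    unfolding quad_form_def by (intro sum.cong) auto
  finally show ?thesis by (simp add: power2_eq_square)
qed

lemma coord_expand:
  assumes P: "P \<in> carrier_mat m m" and PP: "transpose_mat P * P = 1\<^sub>m m" and k: "k < m"
  shows "coord m P (\<lambda>p. \<Sum>j<m. P $$ (p, j) * y j) k = y k"
proof -
  have orth: "(\<Sum>p<m. P $$ (p, k) * P $$ (p, j)) = (if j = k then 1 else 0)" if "j < m" for j
    using arg_cong[OF PP, of "\<lambda>A. A $$ (k, j)"] mult_mat_nth[of "transpose_mat P" m m P m k j] P k that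
    by (simp del: index_mult_mat(1))
  have "coord m P (\<lambda>p. \<Sum>j<m. P $$ (p, j) * y j) k = (\<Sum>j<m. (\<Sum>p<m. P $$ (p, k) * P $$ (p, j)) * y j)"
    unfolding sum_distrib_left sum_distrib_right by (subst sum.swap) (simp add: mult_ac)
  also have "\<dots> = (\<Sum>j<m. if j = k then y k else 0)"
    by (intro sum.cong) (auto simp: orth)
  finally show ?thesis using k by simp
qed

text \<open>
  The eigenvalue \<open>d i\<close> is the value of the quadratic form at the \<open>i\<close>-th column of \<open>P\<close>.
\<close>
lemma psd_orthogonal_diagonalization:
  assumes M: "psd_mat m M"
  obtains P d where "orthogonal_diagonalization m M P d" "\<forall>i<m. 0 \<le> d i"
proof -
  obtain P d where od: "orthogonal_diagonalization m M P d"
    using M real_spectral_theorem[of M m] unfolding psd_mat_def by blast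
  then have P: "P \<in> carrier_mat m m" and PP: "transpose_mat P * P = 1\<^sub>m m"
    and Md: "M = P * mat_diag m d * transpose_mat P"
    by (auto simp: orthogonal_diagonalization_def)
  have "0 \<le> d i" if i: "i < m" for i
  proof -
    let ?y = "\<lambda>j. if j = i then 1 else 0 :: real"
    have "0 \<le> quad_form M (\<lambda>p. \<Sum>j<m. P $$ (p, j) * ?y j)" using M unfolding psd_mat_def by blast
    also have "\<dots> = (\<Sum>k<m. d k * (?y k)\<^sup>2)"
      unfolding Md quad_form_diagonalized[OF P] by (intro sum.cong refl) (simp only: coord_expand[OF P PP] lessThan_iff)
    also have "\<dots> = (\<Sum>k<m. if k = i then d i else 0)" by (intro sum.cong) auto
    also have "\<dots> = d i" using i by simp
    finally show ?thesis .
  qed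
  with od show thesis using that by blast
qed

text \<open>
  The difference of the two sides is the square \<open>((e + t) y - t w)\<^sup>2 / (e + t)\<close>. This and the next
  lemma state that the minimum over \<open>y\<close> of \<open>e y\<^sup>2 + t (w - y)\<^sup>2\<close> is \<open>t w\<^sup>2 e / (e + t)\<close>, attained at
  \<open>y = t w / (e + t)\<close>.
\<close>
lemma parallel_sum_lower_bound:
  fixes e t w y :: real
  assumes "0 \<le> e" "0 < t"
  shows "t * (w\<^sup>2 * (e / (e + t))) \<le> e * y\<^sup>2 + t * (w - y)\<^sup>2"
proof -
  have "e * y\<^sup>2 + t * (w - y)\<^sup>2 - t * (w\<^sup>2 * (e / (e + t))) = ((e + t) * y - t * w)\<^sup>2 / (e + t)"
    using assms by (simp add: divide_simps) (simp add: power2_eq_square algebra_simps)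
  moreover have "0 \<le> \<dots>" using assms by simp
  ultimately show ?thesis by linarith
qed

lemma parallel_sum_attained:
  fixes d t w :: real
  assumes "0 \<le> d" "0 < t"
  shows "d * (t / (d + t) * w)\<^sup>2 + t * (w - t / (d + t) * w)\<^sup>2 = t * (w\<^sup>2 * (d / (d + t)))"
  using assms by (simp add: divide_simps) (simp add: power2_eq_square algebra_simps)

text \<open>
  The change of basis \<open>W = Q\<^sup>T P\<close> satisfies \<open>W\<^sub>i\<^sub>j d\<^sub>j = e\<^sub>i W\<^sub>i\<^sub>j\<close>, so \<open>W\<^sub>i\<^sub>j \<noteq> 0\<close> only if \<open>d\<^sub>j = e\<^sub>i\<close>. Then
  \<open>W\<^sub>i\<^sub>j f(d\<^sub>j) = f(e\<^sub>i) W\<^sub>i\<^sub>j\<close> for every function \<open>f\<close>, and transforming back gives the claim.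
\<close>
lemma functional_calculus_unique:
  assumes "orthogonal_diagonalization m M P d" and "orthogonal_diagonalization m M Q e"
  shows "P * mat_diag m (\<lambda>i. f (d i)) * transpose_mat P = Q * mat_diag m (\<lambda>i. f (e i)) * transpose_mat Q"
proof -
  let ?P' = "transpose_mat P" and ?Q' = "transpose_mat Q"
  have P: "P \<in> carrier_mat m m" "?P' \<in> carrier_mat m m" and PP: "P * ?P' = 1\<^sub>m m" "?P' * P = 1\<^sub>m m"
    and Md: "M = P * mat_diag m d * ?P'"
    using assms(1) by (auto simp: orthogonal_diagonalization_def)
  have Q: "Q \<in> carrier_mat m m" "?Q' \<in> carrier_mat m m" and QQ: "Q * ?Q' = 1\<^sub>m m" "?Q' * Q = 1\<^sub>m m"
    and Me: "M = Q * mat_diag m e * ?Q'"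
    using assms(2) by (auto simp: orthogonal_diagonalization_def)
  note assoc = assoc_mult_mat[of _ m m _ m _ m]
  define W where "W = ?Q' * P"
  have W: "W \<in> carrier_mat m m" using P Q by (simp add: W_def)
  have D: "mat_diag m g \<in> carrier_mat m m" for g :: "nat \<Rightarrow> real" by simp
  have "W * mat_diag m d = ?Q' * (P * mat_diag m d * (?P' * P))"
    using P Q D[of d] by (simp add: W_def PP assoc right_mult_one_mat[of _ m m] del: mat_diag_dim)
  also have "\<dots> = ?Q' * M * P"
    using P Q D[of d] by (simp add: Md assoc del: mat_diag_dim)
  also have "\<dots> = (?Q' * Q) * mat_diag m e * W"
    using P Q D[of e] by (simp add: Me assoc W_def del: mat_diag_dim)
  also have "\<dots> = mat_diag m e * W"
    using W by (simp add: QQ left_mult_one_mat[of _ m m])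
  finally have comm: "W * mat_diag m d = mat_diag m e * W" .
  have "W $$ (i, j) * f (d j) = f (e i) * W $$ (i, j)" if "i < m" "j < m" for i j
  proof -
    have "W $$ (i, j) * d j = e i * W $$ (i, j)"
      using arg_cong[OF comm, of "\<lambda>A. A $$ (i, j)"] that
      by (simp add: mat_diag_mult_left[OF W] mat_diag_mult_right[OF W])
    then show ?thesis by (cases "W $$ (i, j) = 0") auto
  qed
  then have commf: "W * mat_diag m (\<lambda>i. f (d i)) = mat_diag m (\<lambda>i. f (e i)) * W"
    by (intro eq_matI) (auto simp: mat_diag_mult_left[OF W] mat_diag_mult_right[OF W])
  have "P * mat_diag m (\<lambda>i. f (d i)) * ?P' = (Q * ?Q') * P * mat_diag m (\<lambda>i. f (d i)) * ?P'"
    using P by (simp add: QQ left_mult_one_mat[of _ m m])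
  also have "\<dots> = Q * (W * mat_diag m (\<lambda>i. f (d i))) * ?P'"
    using P Q D[of "\<lambda>i. f (d i)"] D[of "\<lambda>i. f (e i)"] by (simp add: W_def assoc del: mat_diag_dim)
  also have "\<dots> = Q * mat_diag m (\<lambda>i. f (e i)) * ?Q' * (P * ?P')"
    unfolding commf using P Q D[of "\<lambda>i. f (d i)"] D[of "\<lambda>i. f (e i)"] by (simp add: W_def assoc del: mat_diag_dim)
  also have "\<dots> = Q * mat_diag m (\<lambda>i. f (e i)) * ?Q'"
    using Q by (simp add: PP right_mult_one_mat[of _ m m])
  finally show ?thesis .
qed

lemma mat_rpow_eq:
  assumes od: "orthogonal_diagonalization m M P d" and d: "\<forall>i<m. 0 \<le> d i"
  shows "mat_rpow M r = P * mat_diag m (\<lambda>i. scalar_rpow (d i) r) * transpose_mat P"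
proof -
  have dim: "dim_row M = m" using od by (auto simp: orthogonal_diagonalization_def)
  show ?thesis
    unfolding mat_rpow_def dim Let_def
  proof (rule the_equality)
    show "\<exists>P' d'. P' \<in> carrier_mat m m \<and> P' * transpose_mat P' = 1\<^sub>m m \<and> transpose_mat P' * P' = 1\<^sub>m m \<and>
      (\<forall>i<m. 0 \<le> d' i) \<and> M = P' * mat_diag m d' * transpose_mat P' \<and>
      P * mat_diag m (\<lambda>i. scalar_rpow (d i) r) * transpose_mat P =
      P' * mat_diag m (\<lambda>i. scalar_rpow (d' i) r) * transpose_mat P'"
      using od d unfolding orthogonal_diagonalization_def by blast
  next
    fix N
    assume "\<exists>P d. P \<in> carrier_mat m m \<and> P * transpose_mat P = 1\<^sub>m m \<and> transpose_mat P * P = 1\<^sub>m m \<and>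
      (\<forall>i<m. 0 \<le> d i) \<and> M = P * mat_diag m d * transpose_mat P \<and>
      N = P * mat_diag m (\<lambda>i. scalar_rpow (d i) r) * transpose_mat P"
    then obtain Q e where "orthogonal_diagonalization m M Q e"
      and N: "N = Q * mat_diag m (\<lambda>i. scalar_rpow (e i) r) * transpose_mat Q"
      unfolding orthogonal_diagonalization_def by blast
    then show "N = P * mat_diag m (\<lambda>i. scalar_rpow (d i) r) * transpose_mat P"
      using functional_calculus_unique[OF _ od, where f = "\<lambda>x. scalar_rpow x r"] by simp
  qed
qed

lemma mat_rpow_carrier_sym:
  assumes M: "psd_mat m M"
  shows "mat_rpow M r \<in> carrier_mat m m" "transpose_mat (mat_rpow M r) = mat_rpow M r"
proof -
  obtain P d where od: "orthogonal_diagonalization m M P d" and d: "\<forall>i<m. 0 \<le> d i"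
    using psd_orthogonal_diagonalization[OF M] .
  have P: "P \<in> carrier_mat m m" using od by (auto simp: orthogonal_diagonalization_def)
  show c: "mat_rpow M r \<in> carrier_mat m m" unfolding mat_rpow_eq[OF od d] using P by auto
  show "transpose_mat (mat_rpow M r) = mat_rpow M r"
  proof (rule eq_matI)
    fix i j assume "i < dim_row (mat_rpow M r)" "j < dim_col (mat_rpow M r)"
    then have ij: "i < m" "j < m" using c by auto
    then have "transpose_mat (mat_rpow M r) $$ (i, j) = mat_rpow M r $$ (j, i)" using c by simp
    also have "\<dots> = mat_rpow M r $$ (i, j)"
      unfolding mat_rpow_eq[OF od d] mult_diag_transpose_nth[OF P ij] mult_diag_transpose_nth[OF P ij(2,1)]
      by (simp add: mult_ac)
    finally show "transpose_mat (mat_rpow M r) $$ (i, j) = mat_rpow M r $$ (i, j)" .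
  qed (use c in auto)
qed

text \<open>
  If \<open>M\<close> does not change when rows and columns are permuted by \<open>\<pi>\<close>, then permuting the rows of a
  diagonalizing matrix gives another one with the same eigenvalues, and the power computed from it
  is the permuted power.
\<close>
lemma mat_rpow_permutation_invariant:
  assumes M: "psd_mat m M"
    and inj: "inj_on \<pi> {..<m}" and range: "\<And>p. p < m \<Longrightarrow> \<pi> p < m"
    and inv: "\<And>p q. p < m \<Longrightarrow> q < m \<Longrightarrow> M $$ (\<pi> p, \<pi> q) = M $$ (p, q)"
    and pq: "p < m" "q < m"
  shows "mat_rpow M r $$ (\<pi> p, \<pi> q) = mat_rpow M r $$ (p, q)"
proof -
  obtain P d where od: "orthogonal_diagonalization m M P d" and d: "\<forall>i<m. 0 \<le> d i"
    using psd_orthogonal_diagonalization[OF M] .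
  have P: "P \<in> carrier_mat m m" and PP: "P * transpose_mat P = 1\<^sub>m m"
    and Md: "M = P * mat_diag m d * transpose_mat P"
    using od by (auto simp: orthogonal_diagonalization_def)
  define R where "R = mat m m (\<lambda>(p, j). P $$ (\<pi> p, j))"
  have R: "R \<in> carrier_mat m m" by (simp add: R_def)
  have RfR: "(R * mat_diag m f * transpose_mat R) $$ (p, q) = (P * mat_diag m f * transpose_mat P) $$ (\<pi> p, \<pi> q)"
    if pq: "p < m" "q < m" for p q f
    unfolding mult_diag_transpose_nth[OF R pq] mult_diag_transpose_nth[OF P range[OF pq(1)] range[OF pq(2)]]
    using pq by (simp add: R_def)
  have "R * mat_diag m (\<lambda>_. 1) * transpose_mat R = 1\<^sub>m m"
  proof (rule eq_matI)
    fix i j assume "i < dim_row (1\<^sub>m m :: real mat)" "j < dim_col (1\<^sub>m m :: real mat)"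
    then have ij: "i < m" "j < m" by auto
    show "(R * mat_diag m (\<lambda>_. 1) * transpose_mat R) $$ (i, j) = 1\<^sub>m m $$ (i, j)"
      unfolding RfR[OF ij] using P ij range inj_onD[OF inj, of i j]
      by (auto simp: PP mat_diag_one right_mult_one_mat[of _ m m] simp del: index_mult_mat(1))
  qed (use R in auto)
  then have RR: "R * transpose_mat R = 1\<^sub>m m" using R by (simp add: mat_diag_one right_mult_one_mat[of _ m m])
  have "M = R * mat_diag m d * transpose_mat R"
  proof (rule eq_matI)
    fix i j assume "i < dim_row (R * mat_diag m d * transpose_mat R)" "j < dim_col (R * mat_diag m d * transpose_mat R)"
    then have ij: "i < m" "j < m" using R by auto
    show "M $$ (i, j) = (R * mat_diag m d * transpose_mat R) $$ (i, j)"
      unfolding RfR[OF ij] Md[symmetric] inv[OF ij] ..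
  qed (use M R in \<open>auto simp: psd_mat_def\<close>)
  then have oR: "orthogonal_diagonalization m M R d"
    using R RR mat_mult_left_right_inverse[OF R _ RR] by (simp add: orthogonal_diagonalization_def)
  have "mat_rpow M r $$ (p, q) = (R * mat_diag m (\<lambda>i. scalar_rpow (d i) r) * transpose_mat R) $$ (p, q)"
    unfolding mat_rpow_eq[OF oR d] ..
  also have "\<dots> = mat_rpow M r $$ (\<pi> p, \<pi> q)"
    unfolding RfR[OF pq] mat_rpow_eq[OF od d] ..
  finally show ?thesis by simp
qed

section \<open>Loewner--Heinz inequality\<close>

text \<open>
  The sums are the quadratic forms of \<open>L(L + t)\<inverse>\<close> and \<open>M(M + t)\<inverse>\<close> at \<open>w\<close>. Up to the factor \<open>t\<close>,
  each is the minimum over \<open>x\<close> of the form of \<open>L\<close>, respectively \<open>M\<close>, at \<open>x\<close> plus \<open>t |w - x|\<^sup>2\<close>.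
  At the minimizer for \<open>M\<close>, passing from \<open>M\<close> to \<open>L\<close> only decreases the value.
\<close>
lemma resolvent_sums_mono:
  assumes L: "orthogonal_diagonalization m L Q e" "\<forall>i<m. 0 \<le> e i"
    and M: "orthogonal_diagonalization m M P d" "\<forall>i<m. 0 \<le> d i"
    and le: "\<And>x. quad_form L x \<le> quad_form M x" and t: "0 < t"
  shows "(\<Sum>k<m. (coord m Q w k)\<^sup>2 * (e k / (e k + t))) \<le> (\<Sum>k<m. (coord m P w k)\<^sup>2 * (d k / (d k + t)))"
proof -
  have P: "P \<in> carrier_mat m m" "P * transpose_mat P = 1\<^sub>m m" "transpose_mat P * P = 1\<^sub>m m"
    and Md: "M = P * mat_diag m d * transpose_mat P"
    and Q: "Q \<in> carrier_mat m m" "Q * transpose_mat Q = 1\<^sub>m m"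
    and Le: "L = Q * mat_diag m e * transpose_mat Q"
    using L M by (auto simp: orthogonal_diagonalization_def)
  \<comment> \<open>the coordinates of the minimizer for M in the eigenbasis of M\<close>
  define y where "y = (\<lambda>k. t / (d k + t) * coord m P w k)"
  define x where "x = (\<lambda>p. \<Sum>j<m. P $$ (p, j) * y j)"
  have x: "coord m P x k = y k" if "k < m" for k
    unfolding x_def using coord_expand[OF P(1,3) that] .
  have diff: "coord m R (\<lambda>p. w p - x p) k = coord m R w k - coord m R x k" for R k
    by (simp add: right_diff_distrib sum_subtractf)
  have parseval: "(\<Sum>p<m. (w p - x p)\<^sup>2) = (\<Sum>k<m. (coord m R w k - coord m R x k)\<^sup>2)"
    if "R \<in> carrier_mat m m" "R * transpose_mat R = 1\<^sub>m m" for R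
    using coord_parseval[OF that, of "\<lambda>p. w p - x p"] by (simp only: diff)
  have "t * (\<Sum>k<m. (coord m Q w k)\<^sup>2 * (e k / (e k + t)))
      \<le> (\<Sum>k<m. e k * (coord m Q x k)\<^sup>2 + t * (coord m Q w k - coord m Q x k)\<^sup>2)"
    unfolding sum_distrib_left using L(2) t by (intro sum_mono parallel_sum_lower_bound) auto
  also have "\<dots> = quad_form L x + t * (\<Sum>p<m. (w p - x p)\<^sup>2)"
    unfolding Le quad_form_diagonalized[OF Q(1)]
    by (simp only: parseval[OF Q] sum.distrib sum_distrib_left)
  also have "\<dots> \<le> quad_form M x + t * (\<Sum>p<m. (w p - x p)\<^sup>2)" using le by simp
  also have "\<dots> = (\<Sum>k<m. d k * (coord m P x k)\<^sup>2 + t * (coord m P w k - coord m P x k)\<^sup>2)"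
    unfolding Md quad_form_diagonalized[OF P(1)]
    by (simp only: parseval[OF P(1,2)] sum.distrib sum_distrib_left)
  also have "\<dots> = t * (\<Sum>k<m. (coord m P w k)\<^sup>2 * (d k / (d k + t)))"
    unfolding sum_distrib_left using M(2) t
    by (intro sum.cong refl) (simp only: x lessThan_iff y_def parallel_sum_attained)
  finally show ?thesis using t by simp
qed

theorem loewner_heinz:
  assumes L: "psd_mat m L" and M: "psd_mat m M"
    and le: "\<And>x. quad_form L x \<le> quad_form M x" and r: "0 \<le> r" "r \<le> 1"
  shows "quad_form (mat_rpow L r) x \<le> quad_form (mat_rpow M r) x"
proof -
  obtain P d where od: "orthogonal_diagonalization m M P d" and d: "\<forall>i<m. 0 \<le> d i"
    using psd_orthogonal_diagonalization[OF M] .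
  obtain Q e where oe: "orthogonal_diagonalization m L Q e" and e: "\<forall>i<m. 0 \<le> e i"
    using psd_orthogonal_diagonalization[OF L] .
  have P: "P \<in> carrier_mat m m" "P * transpose_mat P = 1\<^sub>m m"
    and Md: "M = P * mat_diag m d * transpose_mat P"
    and Q: "Q \<in> carrier_mat m m" "Q * transpose_mat Q = 1\<^sub>m m"
    and Le: "L = Q * mat_diag m e * transpose_mat Q"
    using od oe by (auto simp: orthogonal_diagonalization_def)
  have qM: "quad_form (mat_rpow M r) x = (\<Sum>k<m. scalar_rpow (d k) r * (coord m P x k)\<^sup>2)"
    unfolding mat_rpow_eq[OF od d] quad_form_diagonalized[OF P(1)] ..
  have qL: "quad_form (mat_rpow L r) x = (\<Sum>k<m. scalar_rpow (e k) r * (coord m Q x k)\<^sup>2)"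
    unfolding mat_rpow_eq[OF oe e] quad_form_diagonalized[OF Q(1)] ..
  consider "r = 0" | "r = 1" | "0 < r" "r < 1" using r by linarith
  then show ?thesis
  proof cases
    case 1
    then show ?thesis
      unfolding qM qL by (simp add: scalar_rpow_def coord_parseval[OF P] coord_parseval[OF Q])
  next
    case 2
    then have "quad_form (mat_rpow M r) x = quad_form M x" "quad_form (mat_rpow L r) x = quad_form L x"
      unfolding qM qL unfolding Md Le quad_form_diagonalized[OF P(1)] quad_form_diagonalized[OF Q(1)]
      using d e by (simp_all add: scalar_rpow_def)
    then show ?thesis using le by simp
  next
    case 3
    have "(\<Sum>k<m. (coord m Q x k)\<^sup>2 * e k powr r) \<le> (\<Sum>k<m. (coord m P x k)\<^sup>2 * d k powr r)"
      using 3 d e by (intro powr_sum_mono_of_resolvent_sums resolvent_sums_mono[OF oe e od d le]) auto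
    then show ?thesis using 3 unfolding qM qL by (simp add: scalar_rpow_def mult.commute)
  qed
qed

section \<open>Block circulant matrices of tensors\<close>

lemma tensor_carrierD:
  assumes "A \<in> tensor_carrier n1 n2 n3"
  shows "length A = n3" "\<And>k. k < n3 \<Longrightarrow> A ! k \<in> carrier_mat n1 n2"
  using assms by (auto simp: tensor_carrier_def)

lemma tensor_dims:
  assumes "A \<in> tensor_carrier n1 n2 n3" "0 < n3"
  shows "t_rows A = n1" "t_cols A = n2"
  using tensor_carrierD(2)[OF assms(1), of 0] assms(2) by auto

lemma tensor_eqI:
  assumes A: "A \<in> tensor_carrier n1 n2 n3" and B: "B \<in> tensor_carrier n1 n2 n3"
    and eq: "\<And>k i j. k < n3 \<Longrightarrow> i < n1 \<Longrightarrow> j < n2 \<Longrightarrow> A ! k $$ (i, j) = B ! k $$ (i, j)"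
  shows "A = B"
proof (rule nth_equalityI)
  fix k assume "k < length A"
  then have k: "k < n3" using tensor_carrierD(1)[OF A] by simp
  show "A ! k = B ! k"
    by (rule eq_matI) (use eq[OF k] tensor_carrierD(2)[OF A k] tensor_carrierD(2)[OF B k] in auto)
qed (use tensor_carrierD(1) A B in auto)

text \<open>
  The number of the slice in block \<open>(a, b)\<close> of a block circulant matrix with \<open>c\<close> block rows.
\<close>
definition block_diff :: "nat \<Rightarrow> nat \<Rightarrow> nat \<Rightarrow> nat" where
  "block_diff c a b = nat ((int a - int b) mod int c)"

lemma int_block_diff: "0 < c \<Longrightarrow> int (block_diff c a b) = (int a - int b) mod int c"
  by (simp add: block_diff_def)

lemma block_diff_less: "0 < c \<Longrightarrow> block_diff c a b < c"
  using int_block_diff[of c a b] by (metis of_nat_less_iff pos_mod_bound of_nat_0_less_iff)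

lemma block_diff_0: "0 < c \<Longrightarrow> a < c \<Longrightarrow> block_diff c a 0 = a"
  by (simp add: block_diff_def)

lemma block_diff_shift:
  assumes "0 < c"
  shows "block_diff c ((a + k) mod c) ((b + k) mod c) = block_diff c a b"
proof -
  have "int (block_diff c ((a + k) mod c) ((b + k) mod c)) = int (block_diff c a b)"
    unfolding int_block_diff[OF assms] by (simp add: of_nat_mod mod_diff_eq)
  then show ?thesis by simp
qed

lemma block_diff_add:
  assumes "0 < c" "a < c"
  shows "(block_diff c a b + b) mod c = a"
proof -
  have "int ((block_diff c a b + b) mod c) = int a"
    using assms by (simp add: of_nat_mod int_block_diff mod_add_left_eq)
  then show ?thesis by simp
qed

lemma block_diff_swap:
  assumes "0 < c"
  shows "(c - block_diff c a b) mod c = block_diff c b a"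
proof -
  have "int ((c - block_diff c a b) mod c) = (int c - (int a - int b) mod int c) mod int c"
    using block_diff_less[OF assms, of a b] by (simp only: of_nat_mod of_nat_diff[OF less_imp_le] int_block_diff[OF assms])
  also have "\<dots> = (int c - (int a - int b)) mod int c" by (rule mod_diff_right_eq)
  also have "\<dots> = (int b - int a + int c) mod int c" by (simp add: algebra_simps)
  also have "\<dots> = int (block_diff c b a)" by (simp add: int_block_diff[OF assms])
  finally show ?thesis by simp
qed

lemma div_block_less: "p < n * c \<Longrightarrow> p div n < (c :: nat)"
  by (simp add: less_mult_imp_div_less mult.commute)

lemma bcirc_carrier:
  assumes "A \<in> tensor_carrier n1 n2 n3" "0 < n3"
  shows "bcirc A \<in> carrier_mat (n1 * n3) (n2 * n3)"
  using tensor_dims[OF assms] tensor_carrierD(1)[OF assms(1)] by (simp add: bcirc_def)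

lemma bcirc_nth:
  assumes "A \<in> tensor_carrier n1 n2 n3" "0 < n3" "p < n1 * n3" "q < n2 * n3"
  shows "bcirc A $$ (p, q) = A ! block_diff n3 (p div n1) (q div n2) $$ (p mod n1, q mod n2)"
  using tensor_dims[OF assms(1,2)] tensor_carrierD(1)[OF assms(1)] assms
  by (simp add: bcirc_def block_diff_def)

lemma block_index_less:
  assumes "k < c" "i < (n :: nat)"
  shows "k * n + i < n * c"
proof -
  have "k * n + i < Suc k * n" using assms(2) by simp
  also have "\<dots> \<le> c * n" using assms(1) by (intro mult_right_mono) auto
  finally show ?thesis by (simp add: mult.commute)
qed

lemma slice_nth_bcirc:
  assumes A: "A \<in> tensor_carrier n1 n2 n3" and k: "k < n3" and ij: "i < n1" "j < n2"
  shows "A ! k $$ (i, j) = bcirc A $$ (k * n1 + i, j)"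
proof -
  have "j < n2 * n3" using block_index_less[of 0 n3 j n2] k ij by simp
  then show ?thesis
    using bcirc_nth[OF A _ block_index_less[OF k ij(1)], of j] k ij by (simp add: block_diff_0)
qed

lemma bcirc_inject:
  assumes "A \<in> tensor_carrier n1 n2 n3" "B \<in> tensor_carrier n1 n2 n3" "bcirc A = bcirc B"
  shows "A = B"
  by (rule tensor_eqI[OF assms(1,2)]) (simp add: slice_nth_bcirc[OF assms(1)] slice_nth_bcirc[OF assms(2)] assms(3))

lemma t_minus_carrier:
  assumes "A \<in> tensor_carrier n1 n2 n3" "B \<in> tensor_carrier n1 n2 n3"
  shows "t_minus A B \<in> tensor_carrier n1 n2 n3"
  using tensor_carrierD[OF assms(1)] tensor_carrierD[OF assms(2)]
  by (auto simp: tensor_carrier_def t_minus_def set_zip intro!: minus_carrier_mat)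

lemma bcirc_t_minus:
  assumes A: "A \<in> tensor_carrier n1 n2 n3" and B: "B \<in> tensor_carrier n1 n2 n3"
    and n: "0 < n1" "0 < n2" "0 < n3"
  shows "bcirc (t_minus A B) = bcirc A - bcirc B"
proof (rule eq_matI)
  note D = t_minus_carrier[OF A B]
  fix p q assume "p < dim_row (bcirc A - bcirc B)" "q < dim_col (bcirc A - bcirc B)"
  then have pq: "p < n1 * n3" "q < n2 * n3" using bcirc_carrier[OF B n(3)] by auto
  define k where "k = block_diff n3 (p div n1) (q div n2)"
  have k: "k < n3" using block_diff_less[OF n(3)] by (simp add: k_def)
  have "t_minus A B ! k = A ! k - B ! k"
    using k tensor_carrierD(1)[OF A] tensor_carrierD(1)[OF B] by (simp add: t_minus_def)
  then show "bcirc (t_minus A B) $$ (p, q) = (bcirc A - bcirc B) $$ (p, q)"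
    using bcirc_nth[OF D n(3) pq] bcirc_nth[OF A n(3) pq] bcirc_nth[OF B n(3) pq]
      bcirc_carrier[OF A n(3)] bcirc_carrier[OF B n(3)] tensor_carrierD(2)[OF B k] pq n
    by (simp flip: k_def)
qed (use bcirc_carrier[OF t_minus_carrier[OF A B] n(3)] bcirc_carrier[OF B n(3)] in auto)

lemma t_transpose_nth:
  assumes "k < length A"
  shows "t_transpose A ! k = transpose_mat (A ! ((length A - k) mod length A))"
proof (cases A)
  case (Cons M Ms)
  then show ?thesis using assms by (cases k) (auto simp: rev_nth Suc_diff_Suc)
qed (use assms in simp)

lemma t_transpose_carrier:
  assumes "A \<in> tensor_carrier n1 n2 n3"
  shows "t_transpose A \<in> tensor_carrier n2 n1 n3"
  using assms by (cases A) (auto simp: tensor_carrier_def)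

text \<open>
  Transposition exchanges the block indices, hence negates their difference modulo \<open>n3\<close>; reversing
  the slices after the first one is exactly \<open>k \<mapsto> - k\<close> modulo \<open>n3\<close>.
\<close>
lemma bcirc_t_transpose:
  assumes A: "A \<in> tensor_carrier n1 n2 n3" and n: "0 < n1" "0 < n2" "0 < n3"
  shows "bcirc (t_transpose A) = transpose_mat (bcirc A)"
proof (rule eq_matI)
  note T = t_transpose_carrier[OF A]
  fix p q assume "p < dim_row (transpose_mat (bcirc A))" "q < dim_col (transpose_mat (bcirc A))"
  then have pq: "p < n2 * n3" "q < n1 * n3" using bcirc_carrier[OF A n(3)] by auto
  have "t_transpose A ! block_diff n3 (p div n2) (q div n1)
      = transpose_mat (A ! block_diff n3 (q div n1) (p div n2))"
    using t_transpose_nth[of "block_diff n3 (p div n2) (q div n1)" A] block_diff_less[OF n(3)]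
    by (simp add: tensor_carrierD(1)[OF A] block_diff_swap[OF n(3)])
  moreover have "A ! block_diff n3 (q div n1) (p div n2) \<in> carrier_mat n1 n2"
    by (intro tensor_carrierD(2)[OF A] block_diff_less n)
  ultimately show "bcirc (t_transpose A) $$ (p, q) = transpose_mat (bcirc A) $$ (p, q)"
    using bcirc_nth[OF T n(3) pq] bcirc_nth[OF A n(3) pq(2,1)] bcirc_carrier[OF A n(3)] pq n
    by simp
qed (use bcirc_carrier[OF t_transpose_carrier[OF A] n(3)] bcirc_carrier[OF A n(3)] in auto)

lemma t_symmetric_iff_bcirc:
  assumes A: "A \<in> tensor_carrier n n n3" and n: "0 < n" "0 < n3"
  shows "t_symmetric A \<longleftrightarrow> transpose_mat (bcirc A) = bcirc A"
  using bcirc_t_transpose[OF A n(1,1,2)] bcirc_inject[OF t_transpose_carrier[OF A] A]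
  by (auto simp: t_symmetric_def)

section \<open>Tensor powers\<close>

text \<open>
  The cyclic shift by \<open>k\<close> blocks of the row (or column) indices of a matrix with \<open>c\<close> blocks of
  size \<open>n\<close>.
\<close>
definition block_shift :: "nat \<Rightarrow> nat \<Rightarrow> nat \<Rightarrow> nat \<Rightarrow> nat" where
  "block_shift n c k p = (p + n * k) mod (n * c)"

lemma block_shift_less: "0 < n \<Longrightarrow> 0 < c \<Longrightarrow> block_shift n c k p < n * c"
  by (simp add: block_shift_def)

lemma block_shift_div: "0 < n \<Longrightarrow> block_shift n c k p div n = (p div n + k) mod c"
  by (simp add: block_shift_def mod_mult2_eq add.commute)

lemma block_shift_mod: "block_shift n c k p mod n = p mod n"
  by (simp add: block_shift_def mod_mod_cancel)

lemma inj_on_block_shift: "inj_on (block_shift n c k) {..<n * c}"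
proof (rule inj_onI)
  fix p q assume pq: "p \<in> {..<n * c}" "q \<in> {..<n * c}" and "block_shift n c k p = block_shift n c k q"
  then have "int ((p + n * k) mod (n * c)) = int ((q + n * k) mod (n * c))" by (simp add: block_shift_def)
  then have "(int p + int (n * k)) mod int (n * c) = (int q + int (n * k)) mod int (n * c)"
    by (simp only: of_nat_mod of_nat_add)
  from mod_diff_cong[OF this refl, of "int (n * k)"] have "int (p mod (n * c)) = int (q mod (n * c))"
    by (simp add: of_nat_mod)
  then show "p = q" using pq by simp
qed

lemma bcirc_block_shift:
  assumes A: "A \<in> tensor_carrier n n n3" and n: "0 < n" "0 < n3" and pq: "p < n * n3" "q < n * n3"
  shows "bcirc A $$ (block_shift n n3 k p, block_shift n n3 k q) = bcirc A $$ (p, q)"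
  using bcirc_nth[OF A n(2) block_shift_less[OF n] block_shift_less[OF n]] bcirc_nth[OF A n(2) pq] n
  by (simp add: block_shift_div block_shift_mod block_diff_shift)

text \<open>
  Converse of the preceding lemma. The slices are read off the first block column, and the shift by
  the block index of \<open>q\<close> carries an entry of that block column to the entry at \<open>(p, q)\<close>.
\<close>
lemma block_circulant_of_shift_invariant:
  assumes N: "N \<in> carrier_mat (n * n3) (n * n3)" and n: "0 < n" "0 < n3"
    and inv: "\<And>k p q. p < n * n3 \<Longrightarrow> q < n * n3 \<Longrightarrow>
      N $$ (block_shift n n3 k p, block_shift n n3 k q) = N $$ (p, q)"
  shows "\<exists>C \<in> tensor_carrier n n n3. bcirc C = N"
proof
  define C where "C = map (\<lambda>k. mat n n (\<lambda>(i, j). N $$ (k * n + i, j))) [0..<n3]"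
  show C: "C \<in> tensor_carrier n n n3" by (auto simp: C_def tensor_carrier_def)
  show "bcirc C = N"
  proof (rule eq_matI)
    fix p q assume "p < dim_row N" "q < dim_col N"
    then have pq: "p < n * n3" "q < n * n3" using N by auto
    define b where "b = block_diff n3 (p div n) (q div n)"
    have b: "b < n3" using block_diff_less[OF n(2)] by (simp add: b_def)
    have q0: "q mod n < n * n3" using block_index_less[of 0 n3 "q mod n" n] n by simp
    have p0: "b * n + p mod n < n * n3" using block_index_less[OF b, of "p mod n" n] n by simp
    have "block_shift n n3 (q div n) (q mod n) = q"
      using pq by (simp add: block_shift_def)
    moreover have "block_shift n n3 (q div n) (b * n + p mod n) = p"
    proof -
      let ?s = "block_shift n n3 (q div n) (b * n + p mod n)"
      have "?s div n = p div n"
        using n block_diff_add[OF n(2) div_block_less[OF pq(1)]] by (simp add: block_shift_div b_def)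
      moreover have "?s mod n = p mod n" by (simp add: block_shift_mod)
      ultimately show ?thesis by (metis div_mult_mod_eq)
    qed
    ultimately have "N $$ (p, q) = N $$ (b * n + p mod n, q mod n)"
      using inv[OF p0 q0, of "q div n"] by simp
    then show "bcirc C $$ (p, q) = N $$ (p, q)"
      using bcirc_nth[OF C n(2) pq] b n by (simp add: C_def flip: b_def)
  qed (use bcirc_carrier[OF C n(2)] N in auto)
qed

text \<open>
  Shift invariance of \<open>bcirc A\<close> passes to its power, which therefore is the \<open>bcirc\<close> of some tensor,
  unique by injectivity. This makes the definite description in \<open>t_power\<close> meaningful.
\<close>
lemma t_power_bcirc:
  assumes A: "A \<in> tensor_carrier n n n3" and n: "0 < n" "0 < n3"
    and psd: "psd_mat (n * n3) (bcirc A)"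
  shows "t_power A r \<in> tensor_carrier n n n3" "bcirc (t_power A r) = mat_rpow (bcirc A) r"
proof -
  have "mat_rpow (bcirc A) r $$ (block_shift n n3 k p, block_shift n n3 k q) = mat_rpow (bcirc A) r $$ (p, q)"
    if "p < n * n3" "q < n * n3" for k p q
    by (rule mat_rpow_permutation_invariant[OF psd inj_on_block_shift block_shift_less[OF n]
          bcirc_block_shift[OF A n] that])
  then obtain C where C: "C \<in> tensor_carrier n n n3" "bcirc C = mat_rpow (bcirc A) r"
    using block_circulant_of_shift_invariant[OF mat_rpow_carrier_sym(1)[OF psd] n] by blast
  have "t_power A r = C"
    unfolding t_power_def tensor_dims[OF A n(2)] tensor_carrierD(1)[OF A]
    by (rule the_equality) (use C bcirc_inject in auto)
  with C show "t_power A r \<in> tensor_carrier n n n3" "bcirc (t_power A r) = mat_rpow (bcirc A) r"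
    by auto
qed

section \<open>Order on symmetric tensors\<close>

text \<open>
  The tensor \<open>X\<close>, having a single column, is the same as its unfolded vector, whose entry \<open>p\<close> sits in
  slice \<open>p div n\<close> and row \<open>p mod n\<close>.
\<close>
lemma t_inner_t_prod:
  assumes A: "A \<in> tensor_carrier n n n3" and X: "X \<in> tensor_carrier n 1 n3" and n: "0 < n" "0 < n3"
  shows "t_inner X (t_prod A X) = quad_form (bcirc A) (\<lambda>p. X ! (p div n) $$ (p mod n, 0))"
proof -
  let ?x = "\<lambda>p. X ! (p div n) $$ (p mod n, 0)"
  have bA: "bcirc A \<in> carrier_mat (n * n3) (n * n3)" by (rule bcirc_carrier[OF A n(2)])
  have U: "t_unfold X \<in> carrier_mat (n * n3) 1"
    using bcirc_carrier[OF X n(2)] tensor_dims[OF X n(2)] by (simp add: t_unfold_def)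
  have Uq: "t_unfold X $$ (q, 0) = ?x q" if "q < n * n3" for q
    using that bcirc_nth[OF X n(2) that, of 0] bcirc_carrier[OF X n(2)] tensor_dims[OF X n(2)] n div_block_less[OF that]
    by (simp add: t_unfold_def block_diff_0)
  define y where "y = (\<lambda>p. \<Sum>q<n * n3. bcirc A $$ (p, q) * ?x q)"
  have prod: "t_prod A X ! k $$ (i, 0) = y (k * n + i)" if "k < n3" "i < n" for k i
  proof -
    have "t_prod A X ! k $$ (i, 0) = (bcirc A * t_unfold X) $$ (k * n + i, 0)"
      using that bA U n tensor_carrierD(1)[OF A] by (simp add: t_prod_def t_fold_def del: index_mult_mat(1))
    also have "\<dots> = (\<Sum>q<n * n3. bcirc A $$ (k * n + i, q) * t_unfold X $$ (q, 0))"
      by (rule mult_mat_nth[OF bA U block_index_less[OF that]]) simp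
    also have "\<dots> = y (k * n + i)" unfolding y_def by (intro sum.cong) (auto simp: Uq)
    finally show ?thesis .
  qed
  have "t_inner X (t_prod A X) = (\<Sum>i<n. \<Sum>k<n3. X ! k $$ (i, 0) * t_prod A X ! k $$ (i, 0))"
    unfolding t_inner_def tensor_dims[OF X n(2)] tensor_carrierD(1)[OF X] by simp
  also have "\<dots> = (\<Sum>k<n3. \<Sum>i<n. X ! k $$ (i, 0) * t_prod A X ! k $$ (i, 0))" by (rule sum.swap)
  also have "\<dots> = (\<Sum>k<n3. \<Sum>i<n. ?x (i + k * n) * y (i + k * n))"
    by (intro sum.cong refl) (simp add: prod add.commute)
  also have "\<dots> = (\<Sum>p<n3 * n. ?x p * y p)" by (rule sum_mult_product[symmetric])
  also have "\<dots> = quad_form (bcirc A) ?x"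
    using bA by (simp add: quad_form_def y_def sum_distrib_left mult_ac)
  finally show ?thesis .
qed

text \<open>
  Every vector is the unfolding of a tensor with one column. At the zero tensor the quadratic
  form is \<open>0\<close>, so nonnegativity on nonzero tensors is nonnegativity on all of them.
\<close>
lemma t_psd_iff_bcirc:
  assumes A: "A \<in> tensor_carrier n n n3" and n: "0 < n" "0 < n3"
  shows "t_psd n n3 A \<longleftrightarrow> psd_mat (n * n3) (bcirc A)"
proof
  assume psd: "t_psd n n3 A"
  have "0 \<le> quad_form (bcirc A) x" for x
  proof -
    define X where "X = map (\<lambda>k. mat n 1 (\<lambda>(i, j). x (k * n + i))) [0..<n3]"
    have X: "X \<in> tensor_carrier n 1 n3" by (auto simp: X_def tensor_carrier_def)
    have "X ! (p div n) $$ (p mod n, 0) = x p" if "p < n * n3" for p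
      using div_block_less[OF that] n by (simp add: X_def)
    then have inner: "t_inner X (t_prod A X) = quad_form (bcirc A) x"
      unfolding t_inner_t_prod[OF A X n] quad_form_def using bcirc_carrier[OF A n(2)] by simp
    show ?thesis
    proof (cases "X = t_zero n 1 n3")
      case True
      have "x p = 0" if "p < n * n3" for p
      proof -
        have "X ! (p div n) $$ (p mod n, 0) = 0"
          unfolding True using div_block_less[OF that] n by (simp add: t_zero_def)
        then show ?thesis using div_block_less[OF that] n by (simp add: X_def)
      qed
      then show ?thesis unfolding quad_form_def using bcirc_carrier[OF A n(2)] by simp
    next
      case False
      then show ?thesis using psd X unfolding inner[symmetric] t_psd_def by blast
    qed
  qed
  then show "psd_mat (n * n3) (bcirc A)"
    using psd bcirc_carrier[OF A n(2)] t_symmetric_iff_bcirc[OF A n] by (auto simp: psd_mat_def t_psd_def)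
next
  assume "psd_mat (n * n3) (bcirc A)"
  then show "t_psd n n3 A"
    using A t_symmetric_iff_bcirc[OF A n] t_inner_t_prod[OF A _ n] by (auto simp: psd_mat_def t_psd_def)
qed

lemma quad_form_minus:
  assumes "M \<in> carrier_mat m m" "L \<in> carrier_mat m m"
  shows "quad_form (M - L) x = quad_form M x - quad_form L x"
  using assms by (simp add: quad_form_def algebra_simps sum_subtractf)

lemma t_ge_iff_bcirc:
  assumes A: "A \<in> tensor_carrier n n n3" and B: "B \<in> tensor_carrier n n n3" and n: "0 < n" "0 < n3"
    and As: "t_symmetric A" and Bs: "t_symmetric B"
  shows "t_ge n n3 A B \<longleftrightarrow> (\<forall>x. quad_form (bcirc B) x \<le> quad_form (bcirc A) x)"
proof -
  have c: "bcirc A \<in> carrier_mat (n * n3) (n * n3)" "bcirc B \<in> carrier_mat (n * n3) (n * n3)"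
    using bcirc_carrier[OF A n(2)] bcirc_carrier[OF B n(2)] .
  have "transpose_mat (bcirc A - bcirc B) = bcirc A - bcirc B"
  proof (rule eq_matI)
    fix i j assume "i < dim_row (bcirc A - bcirc B)" "j < dim_col (bcirc A - bcirc B)"
    then have ij: "i < n * n3" "j < n * n3" using c by auto
    have "bcirc A $$ (j, i) = bcirc A $$ (i, j)" "bcirc B $$ (j, i) = bcirc B $$ (i, j)"
      using As Bs t_symmetric_iff_bcirc[OF A n] t_symmetric_iff_bcirc[OF B n] c ij
      by (metis carrier_matD index_transpose_mat(1))+
    then show "transpose_mat (bcirc A - bcirc B) $$ (i, j) = (bcirc A - bcirc B) $$ (i, j)"
      using c ij by simp
  qed (use c in auto)
  then show ?thesis
    unfolding t_ge_def t_psd_iff_bcirc[OF t_minus_carrier[OF A B] n] bcirc_t_minus[OF A B n(1,1,2)]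
    using A B As Bs c by (auto simp: psd_mat_def quad_form_minus[OF c])
qed

theorem theorem3p1:
  fixes A B :: tensor and n n3 :: nat and r :: real
  assumes "0 < n" and "0 < n3"
    and "A \<in> tensor_carrier n n n3" and "B \<in> tensor_carrier n n n3"
    and "t_ge n n3 A B" and "t_psd n n3 B"
    and "0 \<le> r" and "r \<le> 1"
  shows "t_ge n n3 (t_power A r) (t_power B r)"
proof -
  note n = assms(1,2) and A = assms(3) and B = assms(4)
  have sym: "t_symmetric A" "t_symmetric B" using assms(5) by (auto simp: t_ge_def)
  have le: "quad_form (bcirc B) x \<le> quad_form (bcirc A) x" for x
    using assms(5) t_ge_iff_bcirc[OF A B n sym] by blast
  have pB: "psd_mat (n * n3) (bcirc B)" using assms(6) t_psd_iff_bcirc[OF B n] by blast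
  have "0 \<le> quad_form (bcirc A) x" for x
    using le[of x] pB by (auto simp: psd_mat_def intro: order_trans)
  then have pA: "psd_mat (n * n3) (bcirc A)"
    using sym(1) t_symmetric_iff_bcirc[OF A n] bcirc_carrier[OF A n(2)] by (simp add: psd_mat_def)
  note pwA = t_power_bcirc[OF A n pA, of r] and pwB = t_power_bcirc[OF B n pB, of r]
  have "t_symmetric (t_power A r)" "t_symmetric (t_power B r)"
    using mat_rpow_carrier_sym(2)[OF pA] mat_rpow_carrier_sym(2)[OF pB]
    by (simp_all add: t_symmetric_iff_bcirc[OF pwA(1) n] t_symmetric_iff_bcirc[OF pwB(1) n] pwA(2) pwB(2))
  then show ?thesis
    using t_ge_iff_bcirc[OF pwA(1) pwB(1) n] loewner_heinz[OF pB pA le assms(7,8)] pwA(2) pwB(2) by simp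
qed

end
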